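(* For every fixed finite group $G$, the following decision problem is in uniform $\mathsf{ACC}^0$, and moreover can be solved in linear time. Input: a sequence of elements $c_1,\ldots,c_k\in G$. Question: do there exist $z_1,\ldots,z_k\in G$ with $\prod_{i=1}^k z_i^{-1}c_iz_i=1$?
   Context: The group $G$ is a constant, not part of the input; the input is the word of length $k$ over the finite alphabet $G$ with letters $c_1,\ldots,c_k$. $\mathsf{ACC}^0$ is the class of languages decided by (uniform families of) constant-depth, polynomial-size circuits with unbounded fan-in AND, OR, NOT and modular counting gates $\mathrm{MOD}_q$ for constant $q$. *)

theory Defs
  imports "HOL-Algebra.Group"
begin

section \<open>The decision problem\<close>

definition spherical_solvable :: "('a, 'b) monoid_scheme \<Rightarrow> 'a list set" where
  "spherical_solvable G = {cs \<in> lists (carrier G).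
     \<exists>zs \<in> lists (carrier G). length zs = length cs \<and>
       foldr (\<otimes>\<^bsub>G\<^esub>) (map2 (\<lambda>c z. inv\<^bsub>G\<^esub> z \<otimes>\<^bsub>G\<^esub> c \<otimes>\<^bsub>G\<^esub> z) cs zs) \<one>\<^bsub>G\<^esub> = \<one>\<^bsub>G\<^esub>}"

section \<open>Deterministic multitape Turing machines\<close>

datatype 'a symbol = Blank | Letter 'a | Aux nat

datatype direction = MoveLeft | Stay | MoveRight

record 'a tm =
  tm_tapes :: nat
  tm_states :: "nat set"
  tm_symbols :: "'a symbol set"
  tm_start :: nat
  tm_accept :: nat
  tm_reject :: nat
  tm_delta :: "nat \<Rightarrow> 'a symbol list \<Rightarrow> nat \<times> ('a symbol \<times> direction) list"

definition wf_tm :: "'a set \<Rightarrow> 'a tm \<Rightarrow> bool" where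
  "wf_tm A M \<longleftrightarrow>
     finite (tm_states M) \<and> finite (tm_symbols M) \<and>
     {tm_start M, tm_accept M, tm_reject M} \<subseteq> tm_states M \<and> tm_accept M \<noteq> tm_reject M \<and>
     insert Blank (Letter ` A) \<subseteq> tm_symbols M \<and>
     (\<forall>q \<in> tm_states M. \<forall>ss \<in> lists (tm_symbols M). length ss = tm_tapes M \<longrightarrow>
        (case tm_delta M q ss of (q', acts) \<Rightarrow>
           q' \<in> tm_states M \<and> length acts = tm_tapes M \<and> fst ` set acts \<subseteq> tm_symbols M))"

text \<open>A tape is two-way infinite and is given by its head position and its contents.\<close>

type_synonym 'a tape = "int \<times> (int \<Rightarrow> 'a symbol)"
type_synonym 'a config = "nat \<times> 'a tape list"

definition word_tape :: "'a list \<Rightarrow> 'a tape" where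
  "word_tape w = (0, \<lambda>j. if 0 \<le> j \<and> j < int (length w) then Letter (w ! nat j) else Blank)"

fun tape_act :: "'a symbol \<times> direction \<Rightarrow> 'a tape \<Rightarrow> 'a tape" where
  "tape_act (s, d) (p, f) =
     (case d of MoveLeft \<Rightarrow> p - 1 | Stay \<Rightarrow> p | MoveRight \<Rightarrow> p + 1, f(p := s))"

text \<open>A tuple of words is given to a machine by writing its components on the first tapes,
  one word per tape. The accepting and the rejecting state are halting.\<close>

definition tm_init :: "'a tm \<Rightarrow> 'a list list \<Rightarrow> 'a config" where
  "tm_init M ws = (tm_start M,
     map word_tape ws @ replicate (tm_tapes M - length ws) (word_tape []))"

fun tm_step :: "'a tm \<Rightarrow> 'a config \<Rightarrow> 'a config" where
  "tm_step M (q, ts) =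
     (if q = tm_accept M \<or> q = tm_reject M then (q, ts)
      else (case tm_delta M q (map (\<lambda>(p, f). f p) ts) of
              (q', acts) \<Rightarrow> (q', map2 tape_act acts ts)))"

definition tm_answers_within :: "'a tm \<Rightarrow> 'a list list \<Rightarrow> bool \<Rightarrow> nat \<Rightarrow> bool" where
  "tm_answers_within M ws b t \<longleftrightarrow>
     length ws \<le> tm_tapes M \<and>
     fst ((tm_step M ^^ t) (tm_init M ws)) = (if b then tm_accept M else tm_reject M)"

definition linear_time :: "'a set \<Rightarrow> 'a list set \<Rightarrow> bool" where
  "linear_time A L \<longleftrightarrow> (\<exists>M c. wf_tm A M \<and>
     (\<forall>w \<in> lists A. tm_answers_within M [w] (w \<in> L) (c * (length w + 1))))"

text \<open>Binary notation, least significant digit first, without leading zeros;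
  the number 0 is the empty word.\<close>

fun binary :: "nat \<Rightarrow> bool list" where
  "binary n = (if n = 0 then [] else odd n # binary (n div 2))"

declare binary.simps [simp del]

text \<open>The parameter \<open>m\<close> is the number of arguments besides \<open>n\<close>. All arguments are given in
  binary, but the time bound is logarithmic in \<open>n\<close> alone, however large the other ones are.\<close>

definition log_time :: "nat \<Rightarrow> (nat \<Rightarrow> nat list \<Rightarrow> bool) \<Rightarrow> bool" where
  "log_time m R \<longleftrightarrow> (\<exists>M c. wf_tm UNIV M \<and>
     (\<forall>n xs. length xs = m \<longrightarrow>
        tm_answers_within M (map binary (n # xs)) (R n xs) (c * (length (binary n) + 1))))"

section \<open>Circuits with unbounded fan-in\<close>

text \<open>Inputs are words over an arbitrary finite alphabet: the input gate \<open>Input i a\<close> tests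
  whether the letter at position \<open>i\<close> (counted from 0) is \<open>a\<close>.\<close>

datatype 'a label = Input nat 'a | And | Or | Not | Mod nat

text \<open>Gates are named by natural numbers; \<open>preds C g\<close> is the set of gates that feed gate \<open>g\<close>.
  The output gate is gate 0.\<close>

record 'a circuit =
  gates :: "nat set"
  label :: "nat \<Rightarrow> 'a label"
  preds :: "nat \<Rightarrow> nat set"

definition wires :: "'a circuit \<Rightarrow> (nat \<times> nat) set" where
  "wires C = {(h, g). g \<in> gates C \<and> h \<in> preds C g}"

definition wf_circuit :: "'a set \<Rightarrow> nat \<Rightarrow> 'a circuit \<Rightarrow> bool" where
  "wf_circuit A n C \<longleftrightarrow>
     finite (gates C) \<and> 0 \<in> gates C \<and> acyclic (wires C) \<and>
     (\<forall>g \<in> gates C. preds C g \<subseteq> gates C \<and>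
        (case label C g of
           Input i a \<Rightarrow> i < n \<and> a \<in> A \<and> preds C g = {}
         | And \<Rightarrow> True
         | Or \<Rightarrow> True
         | Not \<Rightarrow> card (preds C g) = 1
         | Mod q \<Rightarrow> 2 \<le> q))"

fun gate_value :: "'a label \<Rightarrow> 'a list \<Rightarrow> nat set \<Rightarrow> (nat \<Rightarrow> bool) \<Rightarrow> bool" where
  "gate_value (Input i a) w X v = (w ! i = a)"
| "gate_value And w X v = (\<forall>h \<in> X. v h)"
| "gate_value Or w X v = (\<exists>h \<in> X. v h)"
| "gate_value Not w X v = (\<forall>h \<in> X. \<not> v h)"
| "gate_value (Mod q) w X v = (q dvd card {h \<in> X. v h})"

inductive evaluates :: "'a circuit \<Rightarrow> 'a list \<Rightarrow> nat \<Rightarrow> bool \<Rightarrow> bool" for C w where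
  "(\<forall>h \<in> preds C g. evaluates C w h (v h)) \<Longrightarrow>
     evaluates C w g (gate_value (label C g) w (preds C g) v)"

lemma gate_value_cong:
  assumes "\<And>h. h \<in> X \<Longrightarrow> v h = v' h"
  shows "gate_value l w X v = gate_value l w X v'"
proof (cases l)
  case (Mod q)
  have "{h \<in> X. v h} = {h \<in> X. v' h}" using assms by auto
  then show ?thesis using Mod by simp
qed (use assms in auto)

lemma evaluates_unique: "evaluates C w g b \<Longrightarrow> evaluates C w g b' \<Longrightarrow> b = b'"
proof (induction arbitrary: b' rule: evaluates.induct)
  case (1 g v)
  from 1(2) obtain v' where v': "\<forall>h \<in> preds C g. evaluates C w h (v' h)"
    and b': "b' = gate_value (label C g) w (preds C g) v'"
    by (auto elim: evaluates.cases)
  show ?case unfolding b' by (rule gate_value_cong) (use 1(1) v' in blast)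
qed

section \<open>Uniform \<open>ACC\<^sup>0\<close>\<close>

text \<open>DLOGTIME-uniformity in the sense of Ruzzo: the direct connection language of the family,
  with the input length \<open>n\<close> given in binary, is decidable in time \<open>O(log n)\<close>. As there are only
  finitely many letters and moduli, it is split here into finitely many relations.\<close>

definition dlogtime_uniform :: "'a set \<Rightarrow> nat set \<Rightarrow> (nat \<Rightarrow> 'a circuit) \<Rightarrow> bool" where
  "dlogtime_uniform A Q C \<longleftrightarrow>
     log_time 2 (\<lambda>n xs. (xs ! 0, xs ! 1) \<in> wires (C n)) \<and>
     (\<forall>l \<in> {And, Or, Not} \<union> Mod ` Q.
        log_time 1 (\<lambda>n xs. xs ! 0 \<in> gates (C n) \<and> label (C n) (xs ! 0) = l)) \<and>
     (\<forall>a \<in> A.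
        log_time 2 (\<lambda>n xs. xs ! 0 \<in> gates (C n) \<and> label (C n) (xs ! 0) = Input (xs ! 1) a))"

text \<open>Polynomial size is imposed by a polynomial bound on the names of the gates, so that names
  have \<open>O(log n)\<close> digits. The depth, the largest number of wires on a path, is at most \<open>d\<close>
  iff there is no path of \<open>d + 1\<close> wires.\<close>

definition uniform_ACC0 :: "'a set \<Rightarrow> 'a list set \<Rightarrow> bool" where
  "uniform_ACC0 A L \<longleftrightarrow> (\<exists>(C :: nat \<Rightarrow> 'a circuit) (d :: nat) (c :: nat) (Q :: nat set).
     finite Q \<and> dlogtime_uniform A Q C \<and>
     (\<forall>n. wf_circuit A n (C n) \<and>
        gates (C n) \<subseteq> {..< n ^ c + c} \<and>
        wires (C n) ^^ (d + 1) = {} \<and>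
        (\<forall>g \<in> gates (C n). \<forall>q. label (C n) g = Mod q \<longrightarrow> q \<in> Q) \<and>
        (\<forall>w \<in> lists A. length w = n \<longrightarrow> evaluates (C n) w 0 (w \<in> L))))"

end

theory Submission
  imports Defs "HOL-Library.Multiset"
begin

text \<open>The set of all products of conjugates of \<open>c\<^sub>1, \<dots>, c\<^sub>k\<close> is a product of conjugacy classes, and
  multiplication by a conjugacy class commutes with multiplication by any other one. So the word acts
  on the finite set of subsets of \<open>G\<close> by commuting maps \<open>f a\<close>. A finite automaton computes the set
  from left to right, hence linear time. As the maps commute, the set depends only on
  the numbers of occurrences of the letters; as the powers of each \<open>f a\<close> are eventually periodic, it
  depends on these numbers only up to a constant threshold and, above it, modulo a constant.

  That there are at least \<open>j + 1\<close> letters \<open>a\<close> before position \<open>i\<close> is a disjunction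
  over \<open>i' < i\<close>, in depth linear in the constant \<open>j\<close>. The residues come from \<open>Mod\<close> gates
  that count only the occurrences preceded by at least \<open>v\<close> others, so that their number is reduced by \<open>v\<close>.
  The wires of this circuit depend only on the kinds of the two gates and on the order of their positions, which a
  machine decides in one simultaneous scan of the digits.\<close>

section \<open>Scanning machines\<close>

definition read_cell :: "'a list \<Rightarrow> nat \<Rightarrow> 'a symbol" where
  "read_cell w t = (if t < length w then Letter (w ! t) else Blank)"

text \<open>All heads move right in lockstep, so cell \<open>t\<close> is read at time
  \<open>t\<close> on every tape; the verdict falls \<open>d\<close> cells past the end of the first
  word. The trace \<open>\<sigma>\<close> is a parameter, so that a user only has to exhibit the
  state after \<open>t\<close> steps and to keep this one trace inside \<open>S\<close>.\<close>

lemma scanner_tm: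
  fixes A :: "'a set" and S :: "'s set" and \<delta> :: "'s \<Rightarrow> 'a symbol list \<Rightarrow> 's"
  assumes "finite A" "finite S" "s0 \<in> S"
  obtains M where "wf_tm A M"
    "\<And>w ws \<sigma>. length ws = m \<Longrightarrow> \<sigma> 0 = s0 \<Longrightarrow>
       (\<And>t. t < length w + d \<Longrightarrow> \<sigma> (Suc t) = \<delta> (\<sigma> t) (map (\<lambda>u. read_cell u t) (w # ws))) \<Longrightarrow>
       (\<And>t. t \<le> length w + d \<Longrightarrow> \<sigma> t \<in> S) \<Longrightarrow>
       tm_answers_within M (w # ws) (acc (\<sigma> (length w + d))) ((d + 1) * (length w + 1))"
proof -
  obtain h :: "'s \<times> nat \<Rightarrow> nat" where h: "inj_on h (S \<times> {..d})"
    using finite_imp_inj_to_nat_seg[of "S \<times> {..d}"] assms(2) by auto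
  \<comment> \<open>Codes start at 2, as 0 and 1 are the halting states.\<close>
  define e where "e x = h x + 2" for x
  have e: "inv_into (S \<times> {..d}) e (e x) = x" if "x \<in> S \<times> {..d}" for x
    using that h by (intro inv_into_f_f) (auto simp: e_def inj_on_def)
  have e2: "\<not> e x < 2" "e x \<noteq> 0" "e x \<noteq> Suc 0" for x by (auto simp: e_def)
  \<comment> \<open>\<open>wf_tm\<close> demands a legal successor for all symbols, hence the
    default \<open>s0\<close>; the trace \<open>\<sigma>\<close> never falls back on it.\<close>
  define nxt where "nxt s ss = (if \<delta> s ss \<in> S then \<delta> s ss else s0)" for s ss
  have nxtS: "nxt s ss \<in> S" for s ss using assms(3) by (auto simp: nxt_def)
  \<comment> \<open>The component \<open>j\<close> of a state counts the blanks read on the first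
    tape; the next blank after \<open>d\<close> of them triggers the verdict. Each cell is rewritten
    with its own symbol.\<close>
  define M :: "'a tm" where "M = \<lparr>tm_tapes = Suc m,
    tm_states = {0, 1} \<union> e ` (S \<times> {..d}), tm_symbols = insert Blank (Letter ` A),
    tm_start = e (s0, 0), tm_accept = 0, tm_reject = 1,
    tm_delta = (\<lambda>q ss. (if q < 2 then q else
       (case inv_into (S \<times> {..d}) e q of (s, j) \<Rightarrow>
          if hd ss \<noteq> Blank then e (nxt s ss, j)
          else if j < d then e (nxt s ss, Suc j)
          else if acc s then 0 else 1),
       map (\<lambda>s. (s, MoveRight)) ss))\<rparr>"
  have wf: "wf_tm A M"
    unfolding wf_tm_def
  proof (intro conjI ballI impI)
    fix q ss assume q: "q \<in> tm_states M" and ss: "ss \<in> lists (tm_symbols M)" "length ss = tm_tapes M"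
    then show "case tm_delta M q ss of (q', acts) \<Rightarrow>
           q' \<in> tm_states M \<and> length acts = tm_tapes M \<and> fst ` set acts \<subseteq> tm_symbols M"
      using nxtS by (auto simp: M_def e e2 split: if_splits)
  qed (use assms in \<open>auto simp: M_def\<close>)
  define cfg where "cfg ws t = map (\<lambda>u. (int t, snd (word_tape u))) ws" for ws :: "'a list list" and t
  have rd: "map (\<lambda>(p, f). f p) (cfg ws t) = map (\<lambda>u. read_cell u t) ws" for ws t
    by (auto simp: cfg_def word_tape_def read_cell_def)
  have act: "map2 tape_act (map (\<lambda>s. (s, MoveRight)) (map (\<lambda>u. read_cell u t) ws)) (cfg ws t)
      = cfg ws (Suc t)" for ws t
    by (induction ws) (auto simp: cfg_def word_tape_def read_cell_def)
  have step: "tm_step M (e (s, j), cfg (w # ws) t) =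
     ((if t < length w then e (nxt s (map (\<lambda>u. read_cell u t) (w # ws)), j)
       else if j < d then e (nxt s (map (\<lambda>u. read_cell u t) (w # ws)), Suc j)
       else if acc s then 0 else 1), cfg (w # ws) (Suc t))"
    if "s \<in> S" "j \<le> d" for s j w ws t
  proof -
    have "hd (map (\<lambda>u. read_cell u t) (w # ws)) = Blank \<longleftrightarrow> \<not> t < length w"
      by (simp add: read_cell_def)
    with that show ?thesis
      unfolding tm_step.simps rd M_def
      using act[of t "w # ws"] by (simp add: e e2 del: list.map)
  qed
  have "tm_answers_within M (w # ws) (acc (\<sigma> (length w + d))) ((d + 1) * (length w + 1))"
    if len: "length ws = m" and 0: "\<sigma> 0 = s0"
      and next_state: "\<And>t. t < length w + d \<Longrightarrow> \<sigma> (Suc t) = \<delta> (\<sigma> t) (map (\<lambda>u. read_cell u t) (w # ws))"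
      and S: "\<And>t. t \<le> length w + d \<Longrightarrow> \<sigma> t \<in> S" for w ws \<sigma>
  proof -
    let ?q = "if acc (\<sigma> (length w + d)) then 0 else 1 :: nat"
    have init: "tm_init M (w # ws) = (e (s0, 0), cfg (w # ws) 0)"
      using len by (simp add: tm_init_def cfg_def word_tape_def M_def)
    have run: "(tm_step M ^^ t) (tm_init M (w # ws)) = (e (\<sigma> t, t - length w), cfg (w # ws) t)"
      if "t \<le> length w + d" for t
      using that
    proof (induction t)
      case (Suc t)
      have "nxt (\<sigma> t) (map (\<lambda>u. read_cell u t) (w # ws)) = \<sigma> (Suc t)"
        using next_state[of t] S[of "Suc t"] Suc.prems by (simp add: nxt_def)
      moreover have "t - length w < d" if "\<not> t < length w" using that Suc.prems by linarith
      ultimately show ?case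
        using Suc S[of t] by (simp add: step Suc_diff_le del: list.map tm_step.simps)
    qed (simp add: init 0)
    have halted: "tm_step M (?q, ts) = (?q, ts)" for ts by (simp add: M_def)
    have fin: "\<exists>ts. (tm_step M ^^ (Suc (length w + d) + r)) (tm_init M (w # ws)) = (?q, ts)" for r
    proof (induction r)
      case 0
      show ?case
        using run[of "length w + d"] S[of "length w + d"]
        by (simp add: step del: list.map tm_step.simps)
    next
      case (Suc r)
      then show ?case using halted by (metis add_Suc_right comp_apply funpow.simps(2))
    qed
    \<comment> \<open>The verdict is reached after \<open>Suc (length w + d)\<close> steps; the
      remaining ones idle in a halting state.\<close>
    have time: "(d + 1) * (length w + 1) = Suc (length w + d) + d * length w" by simp
    obtain ts where "(tm_step M ^^ ((d + 1) * (length w + 1))) (tm_init M (w # ws)) = (?q, ts)"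
      using fin[of "d * length w"] unfolding time by blast
    then show ?thesis
      using len by (simp add: tm_answers_within_def M_def)
  qed
  with wf that show ?thesis by blast
qed

text \<open>A finite automaton is a scan of one tape with \<open>d = 0\<close>; its trace is the
  fold over the prefixes.\<close>

lemma linear_time_fold:
  fixes A :: "'a set" and f :: "'a \<Rightarrow> 's \<Rightarrow> 's"
  assumes "finite A" "finite S" "s0 \<in> S" "\<And>a s. a \<in> A \<Longrightarrow> s \<in> S \<Longrightarrow> f a s \<in> S"
    and L: "\<And>w. w \<in> lists A \<Longrightarrow> w \<in> L \<longleftrightarrow> acc (fold f w s0)"
  shows "linear_time A L"
proof -
  obtain M where wf: "wf_tm A M" and M: "\<And>w ws \<sigma>. length ws = 0 \<Longrightarrow> \<sigma> 0 = s0 \<Longrightarrow>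
       (\<And>t. t < length w + 0 \<Longrightarrow> \<sigma> (Suc t) =
         (\<lambda>s ss. case hd ss of Letter a \<Rightarrow> f a s | _ \<Rightarrow> s) (\<sigma> t) (map (\<lambda>u. read_cell u t) (w # ws))) \<Longrightarrow>
       (\<And>t. t \<le> length w + 0 \<Longrightarrow> \<sigma> t \<in> S) \<Longrightarrow>
       tm_answers_within M (w # ws) (acc (\<sigma> (length w + 0))) ((0 + 1) * (length w + 1))"
    by (rule scanner_tm[OF assms(1-3), where m = 0 and d = 0 and acc = acc
      and \<delta> = "\<lambda>s ss. case hd ss of Letter a \<Rightarrow> f a s | _ \<Rightarrow> s"]) blast
  have S: "fold f w s0 \<in> S" if "w \<in> lists A" for w
    using that by (induction w rule: rev_induct) (auto intro: assms)
  have "tm_answers_within M [w] (w \<in> L) (1 * (length w + 1))" if "w \<in> lists A" for w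
  proof -
    have "take t w \<in> lists A" for t using that by (auto dest: in_set_takeD)
    then have "tm_answers_within M [w] (acc (fold f (take (length w + 0) w) s0)) ((0 + 1) * (length w + 1))"
      by (intro M) (auto simp: take_Suc_conv_app_nth read_cell_def S)
    then show ?thesis using L[OF that] by simp
  qed
  with wf show ?thesis unfolding linear_time_def by blast
qed

section \<open>Binary digits and the comparison of numbers\<close>

lemma length_binary: "t < length (binary x) \<longleftrightarrow> 2 ^ t \<le> x"
proof (induction x arbitrary: t rule: binary.induct)
  case (1 x)
  show ?case
  proof (cases t)
    case 0
    then show ?thesis by (subst binary.simps) auto
  next
    case (Suc u)
    show ?thesis
      using 1[of u] Suc by (subst binary.simps) (auto simp: less_eq_div_iff_mult_less_eq mult.commute)
  qed
qed

lemma nth_binary: "t < length (binary x) \<Longrightarrow> binary x ! t = bit x t"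
proof (induction x arbitrary: t rule: binary.induct)
  case (1 x)
  have "x \<noteq> 0" using 1(2) by (cases "x = 0") (simp_all add: binary.simps[of 0])
  then have "binary x = odd x # binary (x div 2)" by (subst binary.simps) simp
  then show ?case using 1 \<open>x \<noteq> 0\<close> by (cases t) (auto simp: bit_0 bit_Suc)
qed

abbreviation bin_len :: "nat \<Rightarrow> nat" where
  "bin_len n \<equiv> length (binary n)"

lemma less_2_bin_len: "n < 2 ^ bin_len n"
  using length_binary[of "bin_len n" n] by simp

lemma two_pow_bin_len_le: "2 ^ bin_len n \<le> 2 * n + 1"
proof (cases "bin_len n")
  case (Suc t)
  then have "2 ^ t \<le> n" using length_binary[of t n] by simp
  then show ?thesis using Suc by simp
qed simp

definition digit :: "nat \<Rightarrow> nat \<Rightarrow> bool symbol" where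
  "digit x t = (if 2 ^ t \<le> x then Letter (bit x t) else Blank)"

lemma read_cell_binary: "read_cell (binary x) t = digit x t"
  by (simp add: read_cell_def digit_def length_binary nth_binary)

lemma digit_eq_True: "digit x t = Letter True \<longleftrightarrow> bit x t"
proof -
  have "\<not> bit x t" if "\<not> 2 ^ t \<le> x"
    using that by (simp add: bit_nat_def)
  then show ?thesis by (auto simp: digit_def)
qed

lemma digit_add: "digit x (l + t) = digit (x div 2 ^ l) t"
  by (simp add: digit_def bit_nat_def power_add div_mult2_eq less_eq_div_iff_mult_less_eq mult.commute)

text \<open>As \<open>x < 2 ^ k\<close>, cell \<open>k\<close> of \<open>x\<close> is blank; then so
  is that of \<open>y\<close>, which puts \<open>y\<close> below \<open>2 ^ k\<close> too. Thus
  \<open>k + 1\<close> cells suffice to recognize a number below the constant \<open>k\<close>,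
  however long the other number may be.\<close>

lemma map_digit_inject:
  assumes "map (digit x) [0..<Suc k] = map (digit y) [0..<Suc k]" "x < k"
  shows "x = y"
proof -
  have eq: "digit x t = digit y t" if "t \<le> k" for t
    using that assms(1) by (simp del: upt_Suc)
  have "x < 2 ^ k" using assms(2) less_exp[of k] by linarith
  moreover from this have "y < 2 ^ k" using eq[of k] by (auto simp: digit_def split: if_splits)
  ultimately show ?thesis
  proof (intro bit_eqI)
    fix t assume "x < 2 ^ k" "y < 2 ^ k"
    show "bit x t \<longleftrightarrow> bit y t"
    proof (cases "t \<le> k")
      case False
      then have "(2::nat) ^ k \<le> 2 ^ t" by simp
      then have "x < 2 ^ t" "y < 2 ^ t" using \<open>x < 2 ^ k\<close> \<open>y < 2 ^ k\<close> by linarith+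
      then show ?thesis by (simp add: bit_nat_def)
    qed (metis eq digit_eq_True)
  qed
qed

definition cmp :: "nat \<Rightarrow> nat \<Rightarrow> int" where
  "cmp x y = sgn (int x - int y)"

lemma cmp_iff: "cmp x y = -1 \<longleftrightarrow> x < y" "cmp x y = 0 \<longleftrightarrow> x = y" "cmp x y = 1 \<longleftrightarrow> y < x"
  by (auto simp: cmp_def sgn_if)

lemma cmp_range: "cmp x y \<in> {-1, 0, 1}"
  by (auto simp: cmp_def sgn_if)

text \<open>A blank counts as the digit 0, since only \<open>Letter True\<close> is tested.\<close>

definition cmp_digit :: "bool symbol \<Rightarrow> bool symbol \<Rightarrow> int \<Rightarrow> int" where
  "cmp_digit a b c = (if (a = Letter True) = (b = Letter True) then c
     else if a = Letter True then 1 else -1)"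

lemma take_bit_Suc_top: "take_bit (Suc t) x = take_bit t x + (if bit x t then 2 ^ t else (0::nat))"
proof -
  have "take_bit (Suc t) x = x mod (2 ^ t * 2)" by (simp add: take_bit_eq_mod mult.commute)
  also have "\<dots> = 2 ^ t * (x div 2 ^ t mod 2) + x mod 2 ^ t" by (rule mod_mult2_eq)
  finally show ?thesis by (simp add: take_bit_eq_mod bit_nat_def odd_iff_mod_2_eq_one even_iff_mod_2_eq_zero)
qed

text \<open>The parts below digit \<open>t\<close> differ by less than \<open>2 ^ t\<close>, so a
  difference at digit \<open>t\<close> outweighs them.\<close>

lemma cmp_take_bit_Suc:
  "cmp (take_bit (Suc t) x) (take_bit (Suc t) y) =
     cmp_digit (digit x t) (digit y t) (cmp (take_bit t x) (take_bit t y))"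
proof -
  define a b p where "a = take_bit t x" and "b = take_bit t y" and "p = (2::nat) ^ t"
  have "a < p" "b < p" by (simp_all add: a_def b_def p_def take_bit_eq_mod)
  then show ?thesis
    unfolding take_bit_Suc_top cmp_digit_def digit_eq_True cmp_def
      a_def[symmetric] b_def[symmetric] p_def[symmetric]
    by (cases "bit x t"; cases "bit y t") (auto simp: sgn_if)
qed

text \<open>The digits are read least significant first, so a comparison is decided by the last
  position at which the digits differ.\<close>

lemma log_time_digits:
  assumes "m > 0"
    and R: "\<And>n xs. length xs = m \<Longrightarrow> R n xs \<longleftrightarrow>
      (let l = bin_len n; x = hd xs; y = last xs; i = x mod 2 ^ l; j = y mod 2 ^ l
       in x div 2 ^ l < k \<and> y div 2 ^ l < k \<and>
          P (x div 2 ^ l) (y div 2 ^ l) (cmp i n) (cmp j n) (cmp i j))"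
  shows "log_time m R"
proof -
  define dgs where "dgs = {ds. set ds \<subseteq> {Blank, Letter True, Letter False} \<and> length ds \<le> Suc k}"
  define S where "S = {-1, 0, 1 :: int} \<times> {-1, 0, 1 :: int} \<times> {-1, 0, 1 :: int} \<times> dgs \<times> dgs"
  \<comment> \<open>While the first tape shows digits of \<open>n\<close>, the three comparisons are
    updated; past its end, the cells of \<open>x\<close> and \<open>y\<close> are collected in
    \<open>u\<close> and \<open>v\<close>, which thus spell the quotients by
    \<open>2 ^ bin_len n\<close>.\<close>
  define \<delta> where "\<delta> = (\<lambda>(c1, c2, c3, u, v) ss. let a = hd ss; x = ss ! 1; y = last ss in
    if a \<noteq> Blank then (cmp_digit x a c1, cmp_digit y a c2, cmp_digit x y c3, u, v)
    else (c1, c2, c3, u @ [x], v @ [y]))"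
  \<comment> \<open>The collected cells are looked up among the digit strings of the numbers below
    \<open>k\<close>; a quotient of at least \<open>k\<close> matches none of them.\<close>
  define acc where "acc = (\<lambda>(c1, c2, c3, u, v). \<exists>k1 < k. \<exists>k2 < k.
    u = map (digit k1) [0..<Suc k] \<and> v = map (digit k2) [0..<Suc k] \<and> P k1 k2 c1 c2 c3)"
  define s0 where "s0 = (0 :: int, 0 :: int, 0 :: int, [] :: bool symbol list, [] :: bool symbol list)"
  have "finite dgs" unfolding dgs_def by (rule finite_lists_length_le) simp
  then have S: "finite S" "s0 \<in> S" by (auto simp: S_def s0_def dgs_def)
  obtain M where wf: "wf_tm UNIV M" and M: "\<And>w ws \<sigma>. length ws = m \<Longrightarrow> \<sigma> 0 = s0 \<Longrightarrow>
       (\<And>t. t < length w + Suc k \<Longrightarrow> \<sigma> (Suc t) = \<delta> (\<sigma> t) (map (\<lambda>u. read_cell u t) (w # ws))) \<Longrightarrow>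
       (\<And>t. t \<le> length w + Suc k \<Longrightarrow> \<sigma> t \<in> S) \<Longrightarrow>
       tm_answers_within M (w # ws) (acc (\<sigma> (length w + Suc k))) ((Suc k + 1) * (length w + 1))"
    by (rule scanner_tm[OF finite_class.finite_UNIV S, where m = m and d = "Suc k" and acc = acc and \<delta> = \<delta>]) blast
  have "tm_answers_within M (map binary (n # xs)) (R n xs) ((Suc k + 1) * (bin_len n + 1))"
    if len: "length xs = m" for n xs
  proof -
    define l x y where "l = bin_len n" and "x = hd xs" and "y = last xs"
    have xs: "xs \<noteq> []" using len assms(1) by auto
    define cm where "cm a b t = cmp (take_bit (min t l) a) (take_bit (min t l) b)" for a b t
    define \<sigma> where "\<sigma> t = (cm x n t, cm y n t, cm x y t,
       map (digit x) [l..<t], map (digit y) [l..<t])" for t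
    have cmS: "cm a b (Suc t) = (if t < l then cmp_digit (digit a t) (digit b t) (cm a b t) else cm a b t)"
      for a b t
      by (simp add: cm_def cmp_take_bit_Suc min_def)
    have "digit a t \<in> {Blank, Letter True, Letter False}" for a t by (auto simp: digit_def)
    then have dgs: "map (digit a) [l..<t] \<in> dgs" if "t \<le> l + Suc k" for a t
      using that unfolding dgs_def by (auto simp: image_subset_iff)
    have "digit n t \<noteq> Blank \<longleftrightarrow> t < l" for t by (simp add: digit_def l_def length_binary)
    then have step: "\<sigma> (Suc t) = \<delta> (\<sigma> t) (map (\<lambda>x. digit x t) (n # xs))" for t
      using xs by (auto simp: \<sigma>_def \<delta>_def cmS Let_def x_def y_def hd_conv_nth last_map)
    have "tm_answers_within M (binary n # map binary xs) (acc (\<sigma> (bin_len n + Suc k)))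
        ((Suc k + 1) * (bin_len n + 1))"
    proof (rule M)
      show "\<sigma> 0 = s0" by (simp add: \<sigma>_def s0_def cm_def cmp_def)
      show "\<sigma> (Suc t) = \<delta> (\<sigma> t) (map (\<lambda>u. read_cell u t) (binary n # map binary xs))" for t
        using step[of t] by (simp add: read_cell_binary comp_def)
      show "\<sigma> t \<in> S" if "t \<le> bin_len n + Suc k" for t
        unfolding S_def \<sigma>_def using that dgs cmp_range by (auto simp: cm_def l_def)
    qed (use len in simp)
    moreover have "acc (\<sigma> (bin_len n + Suc k)) \<longleftrightarrow> R n xs"
    proof -
      have "map (digit a) [l..<l + Suc k] = map (\<lambda>t. digit a (l + t)) [0..<Suc k]" for a
        by (rule nth_equalityI) (auto simp del: upt_Suc)
      then have buf: "map (digit a) [l..<l + Suc k] = map (digit (a div 2 ^ l)) [0..<Suc k]" for a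
        by (simp add: digit_add)
      have cm: "cm a b (l + Suc k) = cmp (a mod 2 ^ l) (b mod 2 ^ l)" for a b
        by (simp add: cm_def take_bit_eq_mod)
      have n: "n mod 2 ^ l = n" using less_2_bin_len[of n] by (simp add: l_def)
      have "acc (\<sigma> (l + Suc k)) \<longleftrightarrow> x div 2 ^ l < k \<and> y div 2 ^ l < k \<and>
          P (x div 2 ^ l) (y div 2 ^ l) (cmp (x mod 2 ^ l) n) (cmp (y mod 2 ^ l) n)
            (cmp (x mod 2 ^ l) (y mod 2 ^ l))" (is "_ \<longleftrightarrow> ?P")
      proof
        assume "acc (\<sigma> (l + Suc k))"
        then obtain k1 k2 where "k1 < k" "k2 < k"
          "map (digit k1) [0..<Suc k] = map (digit (x div 2 ^ l)) [0..<Suc k]"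
          "map (digit k2) [0..<Suc k] = map (digit (y div 2 ^ l)) [0..<Suc k]"
          and P: "P k1 k2 (cmp (x mod 2 ^ l) n) (cmp (y mod 2 ^ l) n) (cmp (x mod 2 ^ l) (y mod 2 ^ l))"
          unfolding acc_def \<sigma>_def buf cm n case_prod_conv by metis
        then have "k1 = x div 2 ^ l" "k2 = y div 2 ^ l" by (blast dest: map_digit_inject)+
        with P \<open>k1 < k\<close> \<open>k2 < k\<close> show ?P by simp
      next
        assume ?P
        then show "acc (\<sigma> (l + Suc k))" unfolding acc_def \<sigma>_def buf cm n case_prod_conv by blast
      qed
      then show ?thesis using R[OF len, of n] by (simp add: Let_def x_def y_def l_def)
    qed
    ultimately show ?thesis by simp
  qed
  with wf show ?thesis unfolding log_time_def by blast
qed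

section \<open>Table-driven circuits\<close>

text \<open>A gate has a kind \<open>k\<close> from a finite set and a position \<open>i \<le> n\<close>; if the kinds are numbered, its
  name is \<open>k * 2 ^ bin_len n + i\<close>. The position occupies the low digits in order to be aligned with
  the digits of \<open>n\<close> during a scan. A \<open>strict\<close> kind exists only at positions \<open>i < n\<close>. The
  wires are given by a table \<open>rel k' k (cmp i' i)\<close>. The number in an \<open>Input\<close> label of a table is a
  dummy, to be replaced by the position.\<close>

definition table_valid :: "'k set \<Rightarrow> ('k \<Rightarrow> bool) \<Rightarrow> nat \<Rightarrow> 'k \<times> nat \<Rightarrow> bool" where
  "table_valid K strict n = (\<lambda>(k, i). k \<in> K \<and> (i < n \<or> i = n \<and> \<not> strict k))"

definition table_preds ::
  "'k set \<Rightarrow> ('k \<Rightarrow> bool) \<Rightarrow> ('k \<Rightarrow> 'k \<Rightarrow> int \<Rightarrow> bool) \<Rightarrow> nat \<Rightarrow> 'k \<times> nat \<Rightarrow> ('k \<times> nat) set" where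
  "table_preds K strict rel n = (\<lambda>(k, i). {(k', i'). table_valid K strict n (k', i') \<and> rel k' k (cmp i' i)})"

fun place :: "'a label \<Rightarrow> nat \<Rightarrow> 'a label" where
  "place (Input _ a) i = Input i a"
| "place l i = l"

definition table_value :: "'a label \<Rightarrow> nat \<Rightarrow> 'a list \<Rightarrow> 'b set \<Rightarrow> ('b \<Rightarrow> bool) \<Rightarrow> bool" where
  "table_value l i w X v = (case l of Input _ a \<Rightarrow> w ! i = a | And \<Rightarrow> \<forall>x \<in> X. v x | Or \<Rightarrow> \<exists>x \<in> X. v x
     | Not \<Rightarrow> \<forall>x \<in> X. \<not> v x | Mod q \<Rightarrow> q dvd card {x \<in> X. v x})"

text \<open>The renaming has to be injective because \<open>Mod\<close> gates count their true
  wires.\<close>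

lemma table_value_image:
  assumes "inj_on f X"
  shows "gate_value (place l i) w (f ` X) v = table_value l i w X (v \<circ> f)"
proof (cases l)
  case (Mod q)
  have "{h \<in> f ` X. v h} = f ` {x \<in> X. (v \<circ> f) x}" by auto
  moreover have "inj_on f {x \<in> X. (v \<circ> f) x}" using assms by (rule inj_on_subset) auto
  ultimately show ?thesis using Mod by (simp add: table_value_def card_image)
qed (auto simp: table_value_def)

lemma place_eq_iff:
  "l \<in> {And, Or, Not} \<union> range Mod \<Longrightarrow> place l' i = l \<longleftrightarrow> l' = l"
  "place l' i = Input j a \<longleftrightarrow> i = j \<and> (\<exists>p. l' = Input p a)"
  by (cases l'; auto)+

text \<open>For \<open>n \<ge> 2\<close> the constant factor goes into the exponent by
  \<open>3 * K \<le> 2 ^ (3 * K) \<le> n ^ (3 * K)\<close>; for smaller \<open>n\<close> the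
  additive constant suffices.\<close>

lemma table_size_bound: "K * (2 * n + 1) \<le> n ^ (3 * K + 1) + (3 * K + 1)" for K n :: nat
proof (cases "n \<ge> 2")
  case True
  have "3 * K \<le> 2 ^ (3 * K)" by (rule less_imp_le) simp
  also have "\<dots> \<le> n ^ (3 * K)" using True by (rule power_mono) simp
  finally have "3 * K * n \<le> n ^ (3 * K) * n" by simp
  moreover have "K * (2 * n + 1) \<le> 3 * K * n"
    using True by (cases n) (auto simp: algebra_simps)
  ultimately show ?thesis unfolding power_add power_one_right by linarith
next
  case False
  then have "n = 0 \<or> n = 1" by auto
  then show ?thesis by auto
qed

lemma relpow_measure:
  fixes r :: "'b \<Rightarrow> nat"
  shows "(x, y) \<in> R ^^ t \<Longrightarrow> R \<subseteq> {(x, y). r x < r y} \<Longrightarrow> r x + t \<le> r y"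
proof (induction t arbitrary: y)
  case (Suc t)
  then obtain z where "(x, z) \<in> R ^^ t" "(z, y) \<in> R" by auto
  with Suc show ?case by fastforce
qed auto

text \<open>The output gate must be gate 0, so the output kind has to get the number 0.\<close>

lemma enumeration_with_first:
  assumes "finite K" "out \<in> K"
  obtains dec :: "nat \<Rightarrow> 'k" where "bij_betw dec {..<card K} K" "dec 0 = out"
proof -
  obtain h where h: "bij_betw h {1..card (K - {out})} (K - {out})"
    using ex_bij_betw_nat_finite_1[of "K - {out}"] assms(1) by blast
  have "bij_betw (h(0 := out)) {1..card (K - {out})} (K - {out})"
    using h by (subst bij_betw_cong[where g = h]) auto
  then have "bij_betw (h(0 := out)) (insert 0 {1..card (K - {out})}) (insert ((h(0 := out)) 0) (K - {out}))"
    by (intro notIn_Un_bij_betw[of 0 _ _ "K - {out}", simplified]) auto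
  moreover have "insert 0 {1..card (K - {out})} = {..<card K}"
    using card_Suc_Diff1[OF assms] by auto
  moreover have "insert ((h(0 := out)) 0) (K - {out}) = K" using assms(2) by auto
  ultimately show ?thesis by (intro that[of "h(0 := out)"]) auto
qed

text \<open>A rank of kinds that grows along wires bounds the depth and excludes cycles, so any
  assignment \<open>val\<close> satisfying all gate equations is the evaluation. \<open>out\<close>
  is not strict, so gate 0 exists even for the empty word; input kinds are strict, so the position
  they read lies inside the word.\<close>

lemma uniform_ACC0_table:
  fixes A :: "'a set" and K :: "'k set" and lab :: "'k \<Rightarrow> 'a label" and rank :: "'k \<Rightarrow> nat"
  assumes "finite K" "out \<in> K" "\<not> strict out" "finite Q"
    and lab: "\<And>k. k \<in> K \<Longrightarrow> (case lab k of Input _ a \<Rightarrow> a \<in> A \<and> strict k \<and> (\<forall>k' c. \<not> rel k' k c)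
        | And \<Rightarrow> True | Or \<Rightarrow> True | Not \<Rightarrow> False | Mod q \<Rightarrow> 2 \<le> q \<and> q \<in> Q)"
    and rank: "\<And>k k' c. k \<in> K \<Longrightarrow> k' \<in> K \<Longrightarrow> rel k' k c \<Longrightarrow> rank k' < rank k"
    and val: "\<And>w. w \<in> lists A \<Longrightarrow> \<exists>val. (val (out, 0) \<longleftrightarrow> w \<in> L) \<and>
       (\<forall>k i. table_valid K strict (length w) (k, i) \<longrightarrow>
          val (k, i) = table_value (lab k) i w (table_preds K strict rel (length w) (k, i)) val)"
  shows "uniform_ACC0 A L"
proof -
  let ?c = "card K"
  obtain dec where dec: "bij_betw dec {..<?c} K" "dec 0 = out"
    using enumeration_with_first[OF assms(1,2)] .
  have c0: "0 < ?c" using assms(1,2) by (auto simp: card_gt_0_iff)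
  define kp where "kp n g = (dec (g div 2 ^ bin_len n), g mod 2 ^ bin_len n)" for n g
  \<comment> \<open>The quotient is bounded explicitly because \<open>dec\<close> may also take
    values in \<open>K\<close> outside \<open>{..<?c}\<close>.\<close>
  define gs where "gs n = {g. g div 2 ^ bin_len n < ?c \<and> table_valid K strict n (kp n g)}" for n
  define C :: "nat \<Rightarrow> 'a circuit" where "C n = \<lparr>gates = gs n,
      label = (\<lambda>g. place (lab (fst (kp n g))) (snd (kp n g))),
      preds = (\<lambda>g. {h \<in> gs n. rel (fst (kp n h)) (fst (kp n g)) (cmp (snd (kp n h)) (snd (kp n g)))})\<rparr>" for n
  have bound: "gs n \<subseteq> {..<?c * 2 ^ bin_len n}" for n
    by (auto simp: gs_def div_less_iff_less_mult)
  have le: "?c * 2 ^ bin_len n \<le> n ^ (3 * ?c + 1) + (3 * ?c + 1)" for n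
    by (rule order_trans[OF mult_le_mono2[OF two_pow_bin_len_le] table_size_bound])
  have bound': "gs n \<subseteq> {..<n ^ (3 * ?c + 1) + (3 * ?c + 1)}" for n
    using bound lessThan_subset_iff[THEN iffD2, OF le] by (rule subset_trans)
  have inK: "fst (kp n g) \<in> K" if "g \<in> gs n" for n g
    using that by (auto simp: gs_def kp_def table_valid_def)
  have kp_inj: "inj_on (kp n) (gs n)" for n
  proof (rule inj_onI)
    fix g h assume *: "g \<in> gs n" "h \<in> gs n" "kp n g = kp n h"
    then have "dec (g div 2 ^ bin_len n) = dec (h div 2 ^ bin_len n)"
      and mod: "g mod 2 ^ bin_len n = h mod 2 ^ bin_len n" by (simp_all only: kp_def prod.inject)
    moreover have "g div 2 ^ bin_len n < ?c" "h div 2 ^ bin_len n < ?c" using * by (simp_all add: gs_def)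
    ultimately have "g div 2 ^ bin_len n = h div 2 ^ bin_len n"
      using dec(1) by (metis bij_betw_def inj_onD lessThan_iff)
    then have "g div 2 ^ bin_len n * 2 ^ bin_len n + g mod 2 ^ bin_len n =
      h div 2 ^ bin_len n * 2 ^ bin_len n + h mod 2 ^ bin_len n" by (simp only: mod)
    then show "g = h" by (simp only: div_mult_mod_eq)
  qed
  have kp_image: "kp n ` gs n = Collect (table_valid K strict n)" for n
  proof safe
    fix k i assume *: "table_valid K strict n (k, i)"
    then have "k \<in> K" "i \<le> n" by (auto simp: table_valid_def)
    then obtain j where j: "j < ?c" "dec j = k"
      using dec(1) by (metis bij_betw_imp_surj_on imageE lessThan_iff)
    have i: "i < 2 ^ bin_len n" using \<open>i \<le> n\<close> less_2_bin_len[of n] by linarith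
    have "kp n (i + j * 2 ^ bin_len n) = (k, i)" using i j by (simp add: kp_def)
    moreover have "i + j * 2 ^ bin_len n \<in> gs n" using i j * by (simp add: gs_def kp_def)
    ultimately show "(k, i) \<in> kp n ` gs n" by (metis image_eqI)
  qed (auto simp: gs_def)
  define gn where "gn n = the_inv_into (gs n) (kp n)" for n
  have gn: "kp n (gn n x) = x" if "table_valid K strict n x" for n x
    unfolding gn_def by (rule f_the_inv_into_f[OF kp_inj]) (simp add: kp_image that)
  have preds: "preds (C n) g = gn n ` table_preds K strict rel n (kp n g)" for n g
  proof (intro equalityI subsetI)
    fix h assume h: "h \<in> preds (C n) g"
    then have "h = gn n (kp n h)" unfolding gn_def by (simp add: the_inv_into_f_f kp_inj C_def)
    moreover have "kp n h \<in> table_preds K strict rel n (kp n g)"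
      using h by (auto simp: C_def gs_def table_preds_def split: prod.splits)
    ultimately show "h \<in> gn n ` table_preds K strict rel n (kp n g)" by blast
  next
    fix h assume "h \<in> gn n ` table_preds K strict rel n (kp n g)"
    then obtain x where x: "h = gn n x" "x \<in> table_preds K strict rel n (kp n g)" by blast
    then have v: "table_valid K strict n x" by (auto simp: table_preds_def split: prod.splits)
    then have "h \<in> gs n" unfolding x gn_def by (intro the_inv_into_into[OF kp_inj]) (auto simp: kp_image)
    then show "h \<in> preds (C n) g"
      using x gn[OF v] by (auto simp: C_def table_preds_def split: prod.splits)
  qed
  have gn_inj: "inj_on (gn n) (table_preds K strict rel n x)" for n x
    by (rule inj_on_inverseI[of _ "kp n"], rule gn) (auto simp: table_preds_def split: prod.splits)
  have wires_rank: "wires (C n) \<subseteq> {(h, g). rank (fst (kp n h)) < rank (fst (kp n g))}" for n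
    using rank inK by (auto simp: wires_def C_def)
  define d where "d = Max (rank ` K)"
  have d: "rank k \<le> d" if "k \<in> K" for k unfolding d_def using that assms(1) by simp
  have depth: "wires (C n) ^^ (d + 1) = {}" for n
  proof (rule ccontr)
    assume "wires (C n) ^^ (d + 1) \<noteq> {}"
    then obtain h g where hg: "(h, g) \<in> wires (C n) ^^ (d + 1)" by auto
    then have "g \<in> gs n" by (auto simp: wires_def C_def)
    then have "rank (fst (kp n g)) \<le> d" using d inK by blast
    with relpow_measure[OF hg wires_rank] show False by simp
  qed
  have "acyclic (wires (C n))" for n
  proof -
    have "wires (C n) \<subseteq> measure (\<lambda>g. rank (fst (kp n g)))" using wires_rank[of n] by auto
    then show ?thesis by (meson acyclic_subset wf_acyclic wf_measure)
  qed
  have "0 \<in> gs n" for n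
    using assms(2,3) c0 dec(2) by (auto simp: gs_def kp_def table_valid_def)
  have wf: "wf_circuit A n (C n)" for n
    unfolding wf_circuit_def
  proof (intro conjI ballI)
    fix g assume g: "g \<in> gates (C n)"
    then have g': "g \<in> gs n" by (simp add: C_def)
    show "preds (C n) g \<subseteq> gates (C n)" by (auto simp: C_def)
    show "case label (C n) g of Input i a \<Rightarrow> i < n \<and> a \<in> A \<and> preds (C n) g = {} | And \<Rightarrow> True
        | Or \<Rightarrow> True | Not \<Rightarrow> card (preds (C n) g) = 1 | Mod q \<Rightarrow> 2 \<le> q"
      using lab[OF inK[OF g']] g' 
      by (cases "lab (fst (kp n g))") (auto simp: C_def gs_def table_valid_def split: prod.splits)
  next
    show "finite (gates (C n))" using finite_subset[OF bound] by (simp add: C_def)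
    show "0 \<in> gates (C n)" using \<open>0 \<in> gs n\<close> by (simp add: C_def)
  qed fact
  \<comment> \<open>Induction on the rank: the gates that feed \<open>g\<close> already have the
    values prescribed by \<open>val\<close>, and the gate equation carries this over to
    \<open>g\<close>.\<close>
  have evl: "evaluates (C n) w g (val (kp n g))"
    if "n = length w" "g \<in> gs n" and val: "\<forall>k i. table_valid K strict n (k, i) \<longrightarrow>
          val (k, i) = table_value (lab k) i w (table_preds K strict rel n (k, i)) val" for n w g val
    using that(2)
  proof (induction "rank (fst (kp n g))" arbitrary: g rule: less_induct)
    case less
    have "\<forall>h \<in> preds (C n) g. evaluates (C n) w h ((val \<circ> kp n) h)"
    proof
      fix h assume h: "h \<in> preds (C n) g"
      then have "(h, g) \<in> wires (C n)" "h \<in> gs n" using less.prems by (auto simp: wires_def C_def)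
      with less.hyps wires_rank show "evaluates (C n) w h ((val \<circ> kp n) h)" by auto
    qed
    from evaluates.intros[OF this]
    have ev: "evaluates (C n) w g (gate_value (label (C n) g) w (preds (C n) g) (val \<circ> kp n))" .
    obtain k i where ki: "kp n g = (k, i)" by fastforce
    have "gate_value (label (C n) g) w (preds (C n) g) (val \<circ> kp n) =
      table_value (lab k) i w (table_preds K strict rel n (k, i)) (val \<circ> kp n \<circ> gn n)"
      unfolding preds table_value_image[OF gn_inj, symmetric] by (simp add: C_def ki)
    also have "\<dots> = table_value (lab k) i w (table_preds K strict rel n (k, i)) val"
    proof -
      have "(val \<circ> kp n \<circ> gn n) x = val x" if "x \<in> table_preds K strict rel n (k, i)" for x
        using that gn by (auto simp: table_preds_def)
      then show ?thesis unfolding table_value_def by (auto split: label.split cong: conj_cong)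
    qed
    also have "\<dots> = val (k, i)" using val less.prems ki by (auto simp: gs_def)
    finally show ?case using ev ki by simp
  qed
  have eval0: "evaluates (C n) w 0 (w \<in> L)" if w: "w \<in> lists A" "length w = n" for n w
  proof -
    obtain v where "v (out, 0) \<longleftrightarrow> w \<in> L" "\<forall>k i. table_valid K strict (length w) (k, i) \<longrightarrow>
          v (k, i) = table_value (lab k) i w (table_preds K strict rel (length w) (k, i)) v"
      using val[OF w(1)] by blast
    with evl[OF w(2)[symmetric] \<open>0 \<in> gs n\<close>, of v] w(2) show ?thesis by (simp add: kp_def dec(2))
  qed
  have gs_iff: "g \<in> gs n \<longleftrightarrow> g div 2 ^ bin_len n < ?c \<and>
     (cmp (g mod 2 ^ bin_len n) n = -1 \<or>
      cmp (g mod 2 ^ bin_len n) n = 0 \<and> \<not> strict (dec (g div 2 ^ bin_len n)))" for n g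
    using dec(1) by (auto simp: gs_def kp_def table_valid_def cmp_iff bij_betw_def)
  have len2: "length xs = 2 \<longleftrightarrow> (\<exists>x y. xs = [x, y])" for xs :: "nat list"
    by (auto simp: length_Suc_conv numeral_2_eq_2)
  have "dlogtime_uniform A Q C"
    unfolding dlogtime_uniform_def
  proof (intro conjI ballI)
    show "log_time 2 (\<lambda>n xs. (xs ! 0, xs ! 1) \<in> wires (C n))"
      by (rule log_time_digits[where k = ?c and
          P = "\<lambda>k1 k2 c1 c2 c3. (c1 = -1 \<or> c1 = 0 \<and> \<not> strict (dec k1)) \<and>
            (c2 = -1 \<or> c2 = 0 \<and> \<not> strict (dec k2)) \<and> rel (dec k1) (dec k2) c3"])
        (auto simp: wires_def C_def gs_iff kp_def len2 Let_def)
  next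
    fix l :: "'a label" assume "l \<in> {And, Or, Not} \<union> Mod ` Q"
    then have l: "l \<in> {And, Or, Not} \<union> range Mod" by auto
    show "log_time 1 (\<lambda>n xs. xs ! 0 \<in> gates (C n) \<and> label (C n) (xs ! 0) = l)"
      by (rule log_time_digits[where k = ?c and
          P = "\<lambda>k1 k2 c1 c2 c3. (c1 = -1 \<or> c1 = 0 \<and> \<not> strict (dec k1)) \<and> lab (dec k1) = l"])
        (auto simp: C_def gs_iff kp_def length_Suc_conv Let_def place_eq_iff(1)[OF l])
  next
    fix a assume "a \<in> A"
    \<comment> \<open>The second argument of an input query is a bare position and may be
      arbitrarily large, so equality with the position of the gate also requires its quotient to
      vanish.\<close>
    have *: "i = y \<longleftrightarrow> y div 2 ^ l = 0 \<and> i = y mod 2 ^ l" if "i < 2 ^ l" for i y l :: nat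
      using that by (auto simp: div_eq_0_iff)
    have **: "x mod 2 ^ l = y \<longleftrightarrow> y div 2 ^ l = 0 \<and> cmp (x mod 2 ^ l) (y mod 2 ^ l) = 0" for x y l :: nat
      by (subst *) (auto simp: cmp_iff)
    show "log_time 2 (\<lambda>n xs. xs ! 0 \<in> gates (C n) \<and> label (C n) (xs ! 0) = Input (xs ! 1) a)"
      by (rule log_time_digits[where k = ?c and
          P = "\<lambda>k1 k2 c1 c2 c3. (c1 = -1 \<or> c1 = 0 \<and> \<not> strict (dec k1)) \<and>
             k2 = 0 \<and> c3 = 0 \<and> (\<exists>p. lab (dec k1) = Input p a)"])
        (use c0 in \<open>auto simp: C_def gs_iff kp_def len2 Let_def place_eq_iff(2) **\<close>)
  qed
  moreover have "q \<in> Q" if "g \<in> gates (C n)" "label (C n) g = Mod q" for n g q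
    using that lab[OF inK, of g n]
    by (cases "lab (fst (kp n g))") (auto simp: C_def)
  moreover have "gates (C n) \<subseteq> {..<n ^ (3 * ?c + 1) + (3 * ?c + 1)}" for n
    using bound' by (simp add: C_def)
  ultimately show ?thesis
    unfolding uniform_ACC0_def using wf depth eval0 assms(4)
    by (intro exI[of _ C] exI[of _ d] exI[of _ "3 * ?c + 1"] exI[of _ Q]) blast
qed

section \<open>Counting letters\<close>

text \<open>The normal form of \<open>c\<close> in the quotient of the additive naturals with index
  \<open>T\<close> and period \<open>q\<close>.\<close>

definition profile :: "nat \<Rightarrow> nat \<Rightarrow> nat \<Rightarrow> nat" where
  "profile T q c = (if c < T then c else T + (c - T) mod q)"

lemma profile_less: "0 < q \<Longrightarrow> profile T q c < T + q"
  by (simp add: profile_def)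

text \<open>The form that the circuit tests: \<open>AtLeast\<close> checks \<open>v \<le> c\<close>,
  and \<open>Match\<close> checks the rest.\<close>

lemma profile_eq_iff:
  assumes "v < T + q"
  shows "profile T q c = v \<longleftrightarrow> v \<le> c \<and> (if v < T then c < Suc v else q dvd c - v)"
proof (cases "v < T")
  case True
  then show ?thesis by (auto simp: profile_def)
next
  case False
  then obtain r where r: "v = T + r" "r < q" using assms by (metis le_add_diff_inverse not_less nat_add_left_cancel_less)
  show ?thesis
  proof (cases "v \<le> c")
    case True
    then have "(c - T) mod q = r mod q \<longleftrightarrow> q dvd c - v"
      using r by (subst mod_eq_dvd_iff_nat) auto
    then show ?thesis using True r by (simp add: profile_def)
  next
    case c: False
    define e where "e = (c - T) mod q"
    have "e \<le> c - T" unfolding e_def by (rule mod_less_eq_dividend)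
    then have "profile T q c \<le> c" unfolding profile_def e_def[symmetric] by auto
    with c show ?thesis by auto
  qed
qed

definition occ :: "'a list \<Rightarrow> 'a \<Rightarrow> nat \<Rightarrow> nat" where
  "occ w a i = count_list (take i w) a"

lemma occ_Suc: "i < length w \<Longrightarrow> occ w a (Suc i) = occ w a i + (if w ! i = a then 1 else 0)"
  by (simp add: occ_def take_Suc_conv_app_nth)

text \<open>The occurrences of \<open>a\<close> are preceded by 0, 1, 2, ... others, so the
  condition discards exactly the first \<open>j\<close>; truncated subtraction covers the case of
  fewer than \<open>j\<close>.\<close>

lemma card_occurrences_after:
  "i \<le> length w \<Longrightarrow> card {i'. i' < i \<and> w ! i' = a \<and> j \<le> occ w a i'} = occ w a i - j"
proof (induction i)
  case (Suc i)
  have "{i'. i' < Suc i \<and> w ! i' = a \<and> j \<le> occ w a i'} =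
     {i'. i' < i \<and> w ! i' = a \<and> j \<le> occ w a i'} \<union> (if w ! i = a \<and> j \<le> occ w a i then {i} else {})"
    by (auto simp: less_Suc_eq)
  then show ?case using Suc by (simp add: occ_Suc Suc_diff_le)
qed (simp add: occ_def)

lemma less_occ_iff:
  assumes "i \<le> length w"
  shows "Suc j \<le> occ w a i \<longleftrightarrow> (\<exists>i'<i. w ! i' = a \<and> j \<le> occ w a i')"
proof -
  have "finite {i'. i' < i \<and> w ! i' = a \<and> j \<le> occ w a i'}" by simp
  then have "0 < occ w a i - j \<longleftrightarrow> {i'. i' < i \<and> w ! i' = a \<and> j \<le> occ w a i'} \<noteq> {}"
    unfolding card_occurrences_after[OF assms, symmetric] by (simp only: card_gt_0_iff simp_thms)
  then show ?thesis by auto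
qed

section \<open>The circuit that counts letters\<close>

datatype 'a kind = Out | Acc "'a \<Rightarrow> nat" | Match 'a nat | AtLeast 'a nat | Step 'a nat
  | Before 'a nat | Here 'a

text \<open>\<open>Step\<close> and \<open>Here\<close> test the letter at their position, which
  rules out position \<open>n\<close>.\<close>

fun count_strict :: "'a kind \<Rightarrow> bool" where
  "count_strict (Step a j) = True"
| "count_strict (Here a) = True"
| "count_strict _ = False"

text \<open>An \<open>And\<close> without wires is constantly true, as the threshold 0
  requires.\<close>

fun count_label :: "nat \<Rightarrow> 'a kind \<Rightarrow> 'a label" where
  "count_label q Out = Or"
| "count_label q (Acc p) = And"
| "count_label q (Match a v) = Mod q"
| "count_label q (AtLeast a j) = (if j = 0 then And else Or)"
| "count_label q (Step a j) = And"
| "count_label q (Before a j) = (if j = 0 then And else Or)"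
| "count_label q (Here a) = Input 0 a"

text \<open>A \<open>Mod\<close> gate with a single wire is a negation; this is how \<open>Match a v\<close> tests
  \<open>\<not> Suc v \<le> c\<close> for a number \<open>v\<close> below the threshold.\<close>

fun count_rel :: "'a set \<Rightarrow> nat \<Rightarrow> ('a \<Rightarrow> nat) set \<Rightarrow> 'a kind \<Rightarrow> 'a kind \<Rightarrow> int \<Rightarrow> bool" where
  "count_rel A T F k' Out c = (k' \<in> Acc ` F)"
| "count_rel A T F k' (Acc p) c = (\<exists>a \<in> A. k' = AtLeast a (p a) \<or> k' = Match a (p a))"
| "count_rel A T F k' (Match a v) c =
     (if v < T then k' = AtLeast a (Suc v) \<and> c = 0 else k' = Step a v)"
| "count_rel A T F k' (AtLeast a j) c = (\<exists>i. j = Suc i \<and> k' = Step a i)"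
| "count_rel A T F k' (Step a j) c = ((k' = Here a \<or> k' = Before a j) \<and> c = 0)"
| "count_rel A T F k' (Before a j) c = (\<exists>i. j = Suc i \<and> k' = Step a i \<and> c = -1)"
| "count_rel A T F k' (Here a) c = False"

text \<open>The rank grows with the threshold and not with the position:
  \<open>Before a (Suc j)\<close> reads \<open>Step a j\<close>, which reads
  \<open>Before a j\<close>. Thresholds of \<open>Step\<close> stay below \<open>V\<close>, so the
  remaining kinds lie above.\<close>

fun count_rank :: "nat \<Rightarrow> 'a kind \<Rightarrow> nat" where
  "count_rank V Out = 2 * V + 5"
| "count_rank V (Acc p) = 2 * V + 4"
| "count_rank V (Match a v) = 2 * V + 3"
| "count_rank V (AtLeast a j) = 2 * V + 2"
| "count_rank V (Step a j) = 2 * j + 1"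
| "count_rank V (Before a j) = 2 * j"
| "count_rank V (Here a) = 0"

text \<open>The intended gate values. Kinds that speak of the whole word have a copy at every
  position, all with the same value.\<close>

fun count_value :: "'a list set \<Rightarrow> 'a set \<Rightarrow> nat \<Rightarrow> nat \<Rightarrow> 'a list \<Rightarrow> 'a kind \<times> nat \<Rightarrow> bool" where
  "count_value L A T q w (Out, i) = (w \<in> L)"
| "count_value L A T q w (Acc p, i) = (\<forall>a \<in> A. profile T q (count_list w a) = p a)"
| "count_value L A T q w (Match a v, i) =
     (if v < T then count_list w a < Suc v else q dvd count_list w a - v)"
| "count_value L A T q w (AtLeast a j, i) = (j \<le> count_list w a)"
| "count_value L A T q w (Step a j, i) = (w ! i = a \<and> j \<le> occ w a i)"
| "count_value L A T q w (Before a j, i) = (j \<le> occ w a i)"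
| "count_value L A T q w (Here a, i) = (w ! i = a)"

text \<open>There are only finitely many vectors of profiles, so the language is a disjunction, over
  the accepted vectors \<open>F\<close>, of conjunctions over the letters.\<close>

lemma uniform_ACC0_counting:
  fixes A :: "'a set"
  assumes "finite A" "2 \<le> q"
    and L: "\<And>w u. w \<in> lists A \<Longrightarrow> u \<in> lists A \<Longrightarrow>
      (\<And>a. a \<in> A \<Longrightarrow> profile T q (count_list w a) = profile T q (count_list u a)) \<Longrightarrow> u \<in> L \<Longrightarrow> w \<in> L"
  shows "uniform_ACC0 A L"
proof -
  define V where "V = T + q"
  define P where "P = (A \<rightarrow>\<^sub>E {..<V})"
  define F where "F = {p \<in> P. \<exists>u \<in> lists A. u \<in> L \<and> (\<forall>a \<in> A. profile T q (count_list u a) = p a)}"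
  define K where "K = {Out} \<union> Acc ` P \<union> case_prod Match ` (A \<times> {..<V}) \<union> case_prod AtLeast ` (A \<times> {..V})
     \<union> case_prod Step ` (A \<times> {..<V}) \<union> case_prod Before ` (A \<times> {..<V}) \<union> Here ` A"
  have "finite P" unfolding P_def using assms(1) by (intro finite_PiE) auto
  then have K: "finite K" "Out \<in> K" using assms(1) by (auto simp: K_def)
  have K_iff: "Acc p \<in> K \<longleftrightarrow> p \<in> P" "Match a v \<in> K \<longleftrightarrow> a \<in> A \<and> v < V"
    "AtLeast a j \<in> K \<longleftrightarrow> a \<in> A \<and> j \<le> V" "Step a j \<in> K \<longleftrightarrow> a \<in> A \<and> j < V"
    "Before a j \<in> K \<longleftrightarrow> a \<in> A \<and> j < V" "Here a \<in> K \<longleftrightarrow> a \<in> A" for p a v j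
    by (auto simp: K_def)
  show ?thesis
  proof (rule uniform_ACC0_table[OF K, where strict = count_strict and Q = "{q}" and lab = "count_label q"
        and rel = "count_rel A T F" and rank = "count_rank V"])
    fix k assume "k \<in> K"
    then show "case count_label q k of Input _ a \<Rightarrow> a \<in> A \<and> count_strict k \<and> (\<forall>k' c. \<not> count_rel A T F k' k c)
        | And \<Rightarrow> True | Or \<Rightarrow> True | Not \<Rightarrow> False | Mod r \<Rightarrow> 2 \<le> r \<and> r \<in> {q}"
      using assms(2) by (cases k) (auto simp: K_iff)
  next
    fix k k' c assume "k \<in> K" "k' \<in> K" "count_rel A T F k' k c"
    then show "count_rank V k' < count_rank V k"
      by (cases k) (auto simp: K_iff split: if_splits)
  next
    fix w assume w: "w \<in> lists A"
    let ?n = "length w"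
    let ?val = "count_value L A T q w"
    let ?valid = "table_valid K count_strict ?n"
    have total: "occ w a ?n = count_list w a" for a by (simp add: occ_def)
    have valid: "?valid (k, i) \<longleftrightarrow> k \<in> K \<and> (i < ?n \<or> i = ?n \<and> \<not> count_strict k)" for k i
      by (simp add: table_valid_def)
    have "?val (k, i) = table_value (count_label q k) i w
        (table_preds K count_strict (count_rel A T F) ?n (k, i)) ?val" if ki: "?valid (k, i)" for k i
    proof -
      let ?X = "table_preds K count_strict (count_rel A T F) ?n (k, i)"
      have X: "x \<in> ?X \<longleftrightarrow> ?valid x \<and> count_rel A T F (fst x) k (cmp (snd x) i)" for x
        by (auto simp: table_preds_def)
      have k: "k \<in> K" and i: "i \<le> ?n" using ki by (auto simp: valid)
      show ?thesis
      proof (cases k)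
        case Out
        have "w \<in> L \<longleftrightarrow> (\<exists>p \<in> F. \<forall>a \<in> A. profile T q (count_list w a) = p a)"
        proof
          assume "w \<in> L"
          let ?p = "restrict (\<lambda>a. profile T q (count_list w a)) A"
          have "?p \<in> F" using \<open>w \<in> L\<close> w assms(2) by (auto simp: F_def P_def V_def profile_less)
          then show "\<exists>p \<in> F. \<forall>a \<in> A. profile T q (count_list w a) = p a" by (rule bexI[rotated]) simp
        next
          assume "\<exists>p \<in> F. \<forall>a \<in> A. profile T q (count_list w a) = p a"
          then obtain u where "u \<in> lists A" "u \<in> L"
            "\<And>a. a \<in> A \<Longrightarrow> profile T q (count_list w a) = profile T q (count_list u a)"
            unfolding F_def by fastforce
          then show "w \<in> L" using L[OF w] by blast
        qed
        also have "\<dots> \<longleftrightarrow> (\<exists>x \<in> ?X. ?val x)"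
        proof
          assume "\<exists>p \<in> F. \<forall>a \<in> A. profile T q (count_list w a) = p a"
          then obtain p where p: "p \<in> F" and val: "\<forall>a \<in> A. profile T q (count_list w a) = p a" by blast
          have "p \<in> P" using p by (simp add: F_def)
          with p have "(Acc p, 0) \<in> ?X" unfolding X unfolding Out by (simp add: valid K_iff)
          with val show "\<exists>x \<in> ?X. ?val x" by (intro bexI[of _ "(Acc p, 0)"]) simp_all
        next
          assume "\<exists>x \<in> ?X. ?val x"
          then obtain p i where "p \<in> F" "?val (Acc p, i)" unfolding X Bex_def unfolding Out by auto
          then show "\<exists>p \<in> F. \<forall>a \<in> A. profile T q (count_list w a) = p a" by auto
        qed
        finally show ?thesis using Out by (simp add: table_value_def)
      next
        case (Acc p)
        then have p: "p a < V" if "a \<in> A" for a using k that by (auto simp: K_iff P_def)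
        \<comment> \<open>Position 0 is valid for these kinds at every length, so it can stand for
          all copies.\<close>
        have "(\<forall>a \<in> A. profile T q (count_list w a) = p a) \<longleftrightarrow>
          (\<forall>a \<in> A. ?val (AtLeast a (p a), 0) \<and> ?val (Match a (p a), 0))"
          using p by (simp add: profile_eq_iff V_def)
        also have "\<dots> \<longleftrightarrow> (\<forall>x \<in> ?X. ?val x)"
        proof
          assume all: "\<forall>a \<in> A. ?val (AtLeast a (p a), 0) \<and> ?val (Match a (p a), 0)"
          show "\<forall>x \<in> ?X. ?val x"
          proof
            fix x assume "x \<in> ?X"
            then obtain a i' where "a \<in> A" "x = (AtLeast a (p a), i') \<or> x = (Match a (p a), i')"
              unfolding X unfolding Acc by (cases x) auto
            with all show "?val x" by auto
          qed
        next
          assume all: "\<forall>x \<in> ?X. ?val x"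
          show "\<forall>a \<in> A. ?val (AtLeast a (p a), 0) \<and> ?val (Match a (p a), 0)"
          proof
            fix a assume a: "a \<in> A"
            then have "(AtLeast a (p a), 0) \<in> ?X" "(Match a (p a), 0) \<in> ?X"
              unfolding X unfolding Acc using p[OF a] by (auto simp: valid K_iff)
            with all show "?val (AtLeast a (p a), 0) \<and> ?val (Match a (p a), 0)" by blast
          qed
        qed
        finally show ?thesis using Acc by (simp add: table_value_def)
      next
        case (Match a v)
        then have a: "a \<in> A" "v < V" using k by (auto simp: K_iff)
        show ?thesis
        proof (cases "v < T")
          case True
          \<comment> \<open>The wire condition \<open>c = 0\<close> leaves a single copy, so at most
            one wire is true; as \<open>q \<ge> 2\<close>, the modulus divides that number iff it is
            0.\<close>
          have "{x \<in> ?X. ?val x} = (if Suc v \<le> count_list w a then {(AtLeast a (Suc v), i)} else {})"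
            unfolding X using Match True a i by (auto simp: valid K_iff cmp_iff)
          then show ?thesis using Match True assms(2) by (auto simp: table_value_def)
        next
          case False
          have "{x \<in> ?X. ?val x} = Pair (Step a v) ` {i'. i' < ?n \<and> w ! i' = a \<and> v \<le> occ w a i'}"
            unfolding X using Match False a i by (auto simp: valid K_iff)
          then have "card {x \<in> ?X. ?val x} = count_list w a - v"
            by (simp add: card_image inj_on_def card_occurrences_after total)
          then show ?thesis using Match False by (simp add: table_value_def)
        qed
      next
        case (AtLeast a j)
        show ?thesis
        proof (cases j)
          case 0
          have "x \<notin> ?X" for x unfolding X unfolding AtLeast 0 by simp
          then have "?X = {}" by blast
          then show ?thesis using AtLeast 0 by (simp add: table_value_def)
        next
          case (Suc j')
          have "x \<in> ?X \<longleftrightarrow> x \<in> Pair (Step a j') ` {..<?n}" for x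
            unfolding X unfolding AtLeast Suc using k
            by (cases x) (auto simp: valid K_iff AtLeast Suc)
          then have "?X = Pair (Step a j') ` {..<?n}" by blast
          moreover have "j \<le> count_list w a \<longleftrightarrow> (\<exists>i'<?n. w ! i' = a \<and> j' \<le> occ w a i')"
            unfolding Suc total[symmetric] by (rule less_occ_iff) simp
          ultimately have "j \<le> count_list w a \<longleftrightarrow> (\<exists>x \<in> ?X. ?val x)" by auto
          then show ?thesis using AtLeast Suc by (simp add: table_value_def)
        qed
      next
        case (Step a j)
        then have "a \<in> A" "j < V" "i < ?n" using k ki by (auto simp: K_iff valid)
        then have "x \<in> ?X \<longleftrightarrow> x \<in> {(Here a, i), (Before a j, i)}" for x
          unfolding X unfolding Step by (cases x) (auto simp: valid K_iff cmp_iff)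
        then have "?X = {(Here a, i), (Before a j, i)}" by blast
        then show ?thesis using Step by (simp add: table_value_def)
      next
        case (Before a j)
        show ?thesis
        proof (cases j)
          case 0
          have "x \<notin> ?X" for x unfolding X unfolding Before 0 by simp
          then have "?X = {}" by blast
          then show ?thesis using Before 0 by (simp add: table_value_def)
        next
          case (Suc j')
          have "x \<in> ?X \<longleftrightarrow> x \<in> Pair (Step a j') ` {..<i}" for x
            unfolding X unfolding Before Suc using k i
            by (cases x) (auto simp: valid K_iff Before Suc cmp_iff)
          then have "?X = Pair (Step a j') ` {..<i}" by blast
          moreover have "j \<le> occ w a i \<longleftrightarrow> (\<exists>i'<i. w ! i' = a \<and> j' \<le> occ w a i')"
            unfolding Suc by (rule less_occ_iff[OF i])
          ultimately have "j \<le> occ w a i \<longleftrightarrow> (\<exists>x \<in> ?X. ?val x)" by auto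
          then show ?thesis using Before Suc by (simp add: table_value_def)
        qed
      qed (simp add: table_value_def)
    qed
    then show "\<exists>val. (val (Out, 0) \<longleftrightarrow> w \<in> L) \<and> (\<forall>k i. ?valid (k, i) \<longrightarrow>
        val (k, i) = table_value (count_label q k) i w
          (table_preds K count_strict (count_rel A T F) ?n (k, i)) val)"
      by (intro exI[of _ ?val]) simp
  qed auto
qed

section \<open>Iterates of commuting maps on a finite set\<close>

text \<open>By the pigeonhole principle every orbit has a repetition among its first
  \<open>Suc (card S)\<close> images, with a period of at most \<open>card S\<close>. This period
  divides \<open>fact (card S)\<close>, so one \<open>q\<close> serves all starting points; the
  factor 2 provides the \<open>q \<ge> 2\<close> that \<open>Mod\<close> gates require.\<close>

lemma funpow_profile:
  fixes g :: "'s \<Rightarrow> 's"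
  assumes S: "finite S" "\<And>s. g s \<in> S"
    and T: "T = Suc (card S)" and q: "q = 2 * fact (card S)"
  shows "g ^^ c = g ^^ profile T q c"
proof
  fix s
  define x where "x c = (g ^^ c) s" for c
  \<comment> \<open>The index is shifted by one because \<open>s\<close> itself may lie outside
    \<open>S\<close>.\<close>
  have "x (Suc c) \<in> S" for c using S(2) by (simp add: x_def)
  then have "card ((\<lambda>c. x (Suc c)) ` {..card S}) \<le> card S"
    using S(1) by (intro card_mono) auto
  then have "\<not> inj_on (\<lambda>c. x (Suc c)) {..card S}" by (intro pigeonhole) simp
  then obtain i j where ij: "i < j" "j \<le> card S" "x (Suc i) = x (Suc j)"
    by (auto simp: inj_on_def) (metis linorder_neqE_nat)
  have shift: "x (c + (j - i)) = x c" if "Suc i \<le> c" for c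
  proof -
    obtain k where k: "c = k + Suc i" using \<open>Suc i \<le> c\<close> by (metis add.commute le_iff_add)
    have add: "x (k + m) = (g ^^ k) (x m)" for m by (simp add: x_def funpow_add)
    have "c + (j - i) = k + Suc j" using k ij(1) by simp
    then show ?thesis using k ij(3) by (simp only: add)
  qed
  have shifts: "x (c + (j - i) * m) = x c" if "Suc i \<le> c" for c m
  proof (induction m)
    case (Suc m)
    have "c + (j - i) * Suc m = c + (j - i) * m + (j - i)" by simp
    then show ?case using Suc shift[of "c + (j - i) * m"] that by (simp only: trans_le_add1)
  qed simp
  have "j - i dvd fact (card S)" using ij by (intro dvd_fact) auto
  then obtain r where r: "q = (j - i) * r" unfolding q by (metis dvd_def dvd_mult)
  have "x c = x (profile T q c)"
  proof (cases "c < T")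
    case False
    \<comment> \<open>Above the threshold, \<open>c\<close> and its profile differ by a multiple of
      \<open>q\<close>, hence of the period \<open>j - i\<close>.\<close>
    have "c = profile T q c + (j - i) * (r * ((c - T) div q))"
      using False mult_div_mod_eq[of q "c - T"] unfolding mult.assoc[symmetric] r[symmetric] profile_def
      by simp
    moreover have "Suc i \<le> profile T q c" using False ij by (simp add: profile_def T)
    ultimately show ?thesis by (metis shifts)
  qed (simp add: profile_def)
  then show "(g ^^ c) s = (g ^^ profile T q c) s" by (simp add: x_def)
qed

text \<open>Commuting maps may be applied in any order, so the word may be sorted into one block per
  letter.\<close>

lemma fold_commuting_eq_funpow:
  assumes w: "set w \<subseteq> set as" and "distinct as"
    and comm: "\<And>a b. a \<in> set as \<Longrightarrow> b \<in> set as \<Longrightarrow> f a \<circ> f b = f b \<circ> f a"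
  shows "fold f w = fold (\<lambda>a. f a ^^ count_list w a) as"
proof -
  define sorted_word where "sorted_word c bs = concat (map (\<lambda>a. replicate (c a) a) bs)" for c :: "'a \<Rightarrow> nat" and bs
  have cnt: "distinct bs \<Longrightarrow> count_list (sorted_word c bs) b = (if b \<in> set bs then c b else 0)" for b bs c
  proof (induction bs)
    case (Cons a bs)
    have "count_list (replicate n a) b = (if a = b then n else 0)" for n by (induction n) auto
    with Cons show ?case by (auto simp: sorted_word_def)
  qed (simp add: sorted_word_def)
  have "mset w = mset (sorted_word (count_list w) as)"
    using w assms(2) by (intro multiset_eqI) (auto simp: count_mset cnt count_list_0_iff)
  then have "fold f w = fold f (sorted_word (count_list w) as)"
    using w by (intro fold_multiset_equiv comm) auto
  also have "\<dots> = fold (\<lambda>a. f a ^^ count_list w a) as"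
  proof -
    have rep: "fold f (replicate n a) = f a ^^ n" for n a
      by (induction n) (simp_all add: funpow_Suc_right del: funpow.simps)
    show ?thesis by (induction as) (simp_all add: sorted_word_def rep fun_eq_iff)
  qed
  finally show ?thesis .
qed

lemma uniform_ACC0_commuting_fold:
  fixes A :: "'a set" and f :: "'a \<Rightarrow> 's \<Rightarrow> 's"
  assumes "finite A" "finite S" and S: "\<And>a s. a \<in> A \<Longrightarrow> f a s \<in> S"
    and comm: "\<And>a b. a \<in> A \<Longrightarrow> b \<in> A \<Longrightarrow> f a \<circ> f b = f b \<circ> f a"
    and L: "\<And>w. w \<in> lists A \<Longrightarrow> w \<in> L \<longleftrightarrow> acc (fold f w s0)"
  shows "uniform_ACC0 A L"
proof -
  define T q where "T = Suc (card S)" and "q = (2 * fact (card S) :: nat)"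
  obtain as where as: "set as = A" "distinct as" using finite_distinct_list[OF assms(1)] by blast
  show ?thesis
  proof (rule uniform_ACC0_counting[OF assms(1)])
    show "2 \<le> q" by (simp add: q_def Suc_le_eq)
    fix w u assume w: "w \<in> lists A" and u: "u \<in> lists A" "u \<in> L"
      and eq: "\<And>a. a \<in> A \<Longrightarrow> profile T q (count_list w a) = profile T q (count_list u a)"
    have "f a ^^ count_list w a = f a ^^ count_list u a" if "a \<in> set as" for a
      using that as eq S funpow_profile[OF assms(2) _ T_def q_def, of "f a"] by metis
    then have "fold (\<lambda>a. f a ^^ count_list w a) as = fold (\<lambda>a. f a ^^ count_list u a) as"
      by (intro ext fold_cong) auto
    moreover have "fold f v = fold (\<lambda>a. f a ^^ count_list v a) as" if "v \<in> lists A" for v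
      using that as comm by (intro fold_commuting_eq_funpow) auto
    ultimately show "w \<in> L" using w u L by metis
  qed
qed

section \<open>Products of conjugacy classes\<close>

text \<open>The product of the conjugacy class of \<open>a\<close> with \<open>N\<close>.
  Intersecting with the carrier makes these maps commute on all sets, hence as functions.\<close>

definition class_mult :: "('a, 'b) monoid_scheme \<Rightarrow> 'a \<Rightarrow> 'a set \<Rightarrow> 'a set" where
  "class_mult G a N = {inv\<^bsub>G\<^esub> z \<otimes>\<^bsub>G\<^esub> a \<otimes>\<^bsub>G\<^esub> z \<otimes>\<^bsub>G\<^esub> x | z x. z \<in> carrier G \<and> x \<in> N \<inter> carrier G}"

context group
begin

lemma class_mult_subset: "a \<in> carrier G \<Longrightarrow> class_mult G a N \<subseteq> carrier G"
  by (auto simp: class_mult_def)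

text \<open>A product \<open>a' b'\<close> of conjugates equals \<open>(a' b' a'\<^sup>-\<^sup>1) a'\<close>.\<close>

lemma class_mult_swap_subset:
  assumes "a \<in> carrier G" "b \<in> carrier G"
  shows "class_mult G a (class_mult G b N) \<subseteq> class_mult G b (class_mult G a N)"
proof
  fix y assume "y \<in> class_mult G a (class_mult G b N)"
  then obtain z z' x where c: "z \<in> carrier G" "z' \<in> carrier G" "x \<in> carrier G" and x: "x \<in> N"
    and y: "y = inv z \<otimes> a \<otimes> z \<otimes> (inv z' \<otimes> b \<otimes> z' \<otimes> x)"
    by (auto simp: class_mult_def)
  define g where "g = inv z \<otimes> a \<otimes> z"
  have g: "g \<in> carrier G" using c assms by (simp add: g_def)
  have cancel: "inv u \<otimes> (u \<otimes> v) = v" if "u \<in> carrier G" "v \<in> carrier G" for u v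
    using that by (simp add: m_assoc[symmetric])
  \<comment> \<open>Conjugating \<open>b\<close> by \<open>z' \<otimes> inv g\<close> yields
    \<open>g \<otimes> b' \<otimes> inv g\<close> for the conjugate
    \<open>b' = inv z' \<otimes> b \<otimes> z'\<close>, and \<open>inv g\<close> cancels against
    the new factor \<open>g\<close>.\<close>
  have "inv (z' \<otimes> inv g) \<otimes> b \<otimes> (z' \<otimes> inv g) \<otimes> (g \<otimes> x) = g \<otimes> (inv z' \<otimes> b \<otimes> z' \<otimes> x)"
    using c g assms by (simp add: inv_mult_group m_assoc cancel)
  then have "y = inv (z' \<otimes> inv g) \<otimes> b \<otimes> (z' \<otimes> inv g) \<otimes> (g \<otimes> x)" by (simp add: y g_def)
  moreover have "g \<otimes> x \<in> class_mult G a N" using c x unfolding class_mult_def g_def by blast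
  ultimately show "y \<in> class_mult G b (class_mult G a N)"
    using c g unfolding class_mult_def[of G b] by blast
qed

lemma class_mult_commute:
  "a \<in> carrier G \<Longrightarrow> b \<in> carrier G \<Longrightarrow> class_mult G a \<circ> class_mult G b = class_mult G b \<circ> class_mult G a"
  by (intro ext) (simp add: class_mult_swap_subset subset_antisym)

lemma foldr_class_mult:
  assumes "cs \<in> lists (carrier G)"
  shows "foldr (class_mult G) cs {\<one>} =
    {foldr (\<otimes>) (map2 (\<lambda>c z. inv z \<otimes> c \<otimes> z) cs zs) \<one> | zs. zs \<in> lists (carrier G) \<and> length zs = length cs}"
  using assms
proof (induction cs rule: list.induct)
  case (Cons c cs)
  let ?p = "\<lambda>cs zs. foldr (\<otimes>) (map2 (\<lambda>c z. inv z \<otimes> c \<otimes> z) cs zs) \<one>"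
  have cs: "\<forall>c \<in> set cs. c \<in> carrier G" using Cons.prems by auto
  have closed: "?p cs zs \<in> carrier G" if "\<forall>z \<in> set zs. z \<in> carrier G" for zs
    using cs that
  proof (induction cs arbitrary: zs rule: list.induct)
    case (Cons c cs)
    then show ?case by (cases zs) auto
  qed simp
  have IH: "foldr (class_mult G) cs {\<one>} = {?p cs zs | zs. zs \<in> lists (carrier G) \<and> length zs = length cs}"
    using Cons by simp
  show ?case
  proof (intro equalityI subsetI)
    fix y assume "y \<in> foldr (class_mult G) (c # cs) {\<one>}"
    then obtain z zs where "z \<in> carrier G" "zs \<in> lists (carrier G)" "length zs = length cs"
      "y = inv z \<otimes> c \<otimes> z \<otimes> ?p cs zs"
      by (auto simp: IH class_mult_def)
    then show "y \<in> {?p (c # cs) zs | zs. zs \<in> lists (carrier G) \<and> length zs = length (c # cs)}"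
      by (intro CollectI exI[of _ "z # zs"]) simp
  next
    fix y assume "y \<in> {?p (c # cs) zs | zs. zs \<in> lists (carrier G) \<and> length zs = length (c # cs)}"
    then obtain zs' where zs': "y = ?p (c # cs) zs'" "zs' \<in> lists (carrier G)" "length zs' = length (c # cs)"
      by blast
    then obtain z zs where "zs' = z # zs" by (cases zs') auto
    with zs' have "z \<in> carrier G" "zs \<in> lists (carrier G)" "length zs = length cs"
      "y = inv z \<otimes> c \<otimes> z \<otimes> ?p cs zs"
      by simp_all
    then show "y \<in> foldr (class_mult G) (c # cs) {\<one>}"
      using closed by (auto simp: IH class_mult_def)
  qed
qed simp

text \<open>The automaton reads from left to right, but the product is nested to the right;
  commutation makes both folds agree.\<close>

lemma spherical_solvable_iff_fold:
  assumes "cs \<in> lists (carrier G)"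
  shows "cs \<in> spherical_solvable G \<longleftrightarrow> \<one> \<in> fold (class_mult G) cs {\<one>}"
proof -
  have "foldr (class_mult G) cs = fold (class_mult G) cs"
    using assms by (intro foldr_fold class_mult_commute) auto
  with foldr_class_mult[OF assms] assms show ?thesis
    by (fastforce simp: spherical_solvable_def)
qed

end

theorem corollary11:
  fixes G :: "('a, 'b) monoid_scheme"
  assumes "group G" and "finite (carrier G)"
  shows "uniform_ACC0 (carrier G) (spherical_solvable G) \<and>
         linear_time (carrier G) (spherical_solvable G)"
proof
  interpret group G by fact
  have fin: "finite (Pow (carrier G))" using assms(2) by simp
  show "uniform_ACC0 (carrier G) (spherical_solvable G)"
    by (rule uniform_ACC0_commuting_fold[OF assms(2) fin])
      (auto simp: spherical_solvable_iff_fold class_mult_commute dest: class_mult_subset)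
  show "linear_time (carrier G) (spherical_solvable G)"
    by (rule linear_time_fold[OF assms(2) fin])
      (auto simp: spherical_solvable_iff_fold dest: class_mult_subset)
qed

end
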